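(* Assume MA($\sigma$-centered). If $\mathcal{I}$ is a strongly unboring ideal, then there is an uncountable separable Mr\'owka space in $\mathrm{FinBW}(\mathcal{I})$.
   Context: An ideal on an infinite countable set $X$ is a family $\mathcal{I}\subseteq\mathcal{P}(X)$ closed under subsets and finite unions, containing all finite subsets, with $X\notin\mathcal{I}$. $\mathcal{I}|C=\{A\cap C:A\in\mathcal{I}\}$. A space $X$ is in $\mathrm{FinBW}(\mathcal{I})$ if $X$ is Hausdorff and for every sequence $(x_n)_{n\in\bigcup\mathcal{I}}$ in $X$ there is $A\notin\mathcal{I}$ with $(x_n)_{n\in A}$ convergent in $X$. $\mathcal{D}_{\mathcal{I}}$ is the set of functions $f:\bigcup\mathcal{I}\to\omega$ with $f^{-1}[\{n\}]\in\mathcal{I}$ for all $n$. An ideal $\mathcal{I}$ on $X$ is $\omega$-diagonalizable by $\mathcal{I}^\star$-universal sets if there are families $\mathcal{Z}_k\subseteq[X]^{<\omega}\setminus\{\emptyset\}$, $k\in\omega$, such that for each $k$ and each $A\in\mathcal{I}$ there is $Z\in\mathcal{Z}_k$ with $Z\cap A=\emptyset$, and for each $A\in\mathcal{I}$ there is $k$ such that no $Z\in\mathcal{Z}_k$ is contained in $A$. $\mathcal{I}$ is strongly unboring if for each $f\in\mathcal{D}_{\mathcal{I}}$ there is $C\notin\mathcal{I}$ such that $f|C$ is finite-to-one and $\mathcal{I}|C$ (an ideal on $C$) is $\omega$-diagonalizable by $(\mathcal{I}|C)^\star$-universal sets. A Mr\'owka space is $\Phi(\mathcal{A})$ for an infinite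 almost disjoint family $\mathcal{A}$ of infinite subsets of $\omega$: underlying set $\omega\cup\mathcal{A}\cup\{\infty\}$, points of $\omega$ isolated, basic neighbourhoods of $A\in\mathcal{A}$ are $\{A\}\cup(A\setminus F)$ ($F\subseteq\omega$ finite), of $\infty$ are $\{\infty\}\cup(\mathcal{A}\setminus G)\cup(\omega\setminus(F\cup\bigcup G))$ ($F\subseteq\omega$, $G\subseteq\mathcal{A}$ finite). *)

theory Defs
  imports "HOL-Analysis.Analysis"
begin

text \<open>A forcing notion: a nonempty set P with a preorder le (le p q: p is stronger than q).\<close>

definition forcing_poset :: "'p set \<Rightarrow> ('p \<Rightarrow> 'p \<Rightarrow> bool) \<Rightarrow> bool" where
  "forcing_poset P le \<longleftrightarrow> P \<noteq> {} \<and> (\<forall>p\<in>P. le p p) \<and>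
     (\<forall>p\<in>P. \<forall>q\<in>P. \<forall>r\<in>P. le p q \<longrightarrow> le q r \<longrightarrow> le p r)"

definition centered_in :: "'p set \<Rightarrow> ('p \<Rightarrow> 'p \<Rightarrow> bool) \<Rightarrow> 'p set \<Rightarrow> bool" where
  "centered_in P le C \<longleftrightarrow> C \<subseteq> P \<and>
     (\<forall>F. finite F \<and> F \<subseteq> C \<longrightarrow> (\<exists>r\<in>P. \<forall>q\<in>F. le r q))"

definition sigma_centered :: "'p set \<Rightarrow> ('p \<Rightarrow> 'p \<Rightarrow> bool) \<Rightarrow> bool" where
  "sigma_centered P le \<longleftrightarrow> (\<exists>C :: nat \<Rightarrow> 'p set. (\<forall>n. centered_in P le (C n)) \<and> P = (\<Union>n. C n))"

definition dense_in :: "'p set \<Rightarrow> ('p \<Rightarrow> 'p \<Rightarrow> bool) \<Rightarrow> 'p set \<Rightarrow> bool" where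
  "dense_in P le D \<longleftrightarrow> D \<subseteq> P \<and> (\<forall>p\<in>P. \<exists>d\<in>D. le d p)"

definition filter_in :: "'p set \<Rightarrow> ('p \<Rightarrow> 'p \<Rightarrow> bool) \<Rightarrow> 'p set \<Rightarrow> bool" where
  "filter_in P le G \<longleftrightarrow> G \<subseteq> P \<and> G \<noteq> {} \<and>
     (\<forall>p\<in>G. \<forall>q\<in>P. le p q \<longrightarrow> q \<in> G) \<and>
     (\<forall>p\<in>G. \<forall>q\<in>G. \<exists>r\<in>G. le r p \<and> le r q)"

text \<open>MA(sigma-centered): for every sigma-centered poset and every family of fewer than
  continuum many dense sets there is a filter meeting all of them. Posets are taken with
  carrier a subset of the type nat set (of size continuum); since the relevant posets
  may be assumed to have size at most continuum, this is the usual axiom.\<close>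

definition MA_sigma_centered :: bool where
  "MA_sigma_centered \<longleftrightarrow>
    (\<forall>(P :: nat set set) le. forcing_poset P le \<and> sigma_centered P le \<longrightarrow>
       (\<forall>\<D> :: nat set set set. (\<forall>D\<in>\<D>. dense_in P le D) \<and> (card_of \<D>, card_of (UNIV :: real set)) \<in> ordLess \<longrightarrow>
          (\<exists>G. filter_in P le G \<and> (\<forall>D\<in>\<D>. G \<inter> D \<noteq> {}))))"

definition is_ideal_on :: "'a set \<Rightarrow> 'a set set \<Rightarrow> bool" where
  "is_ideal_on X I \<longleftrightarrow> I \<subseteq> Pow X \<and>
     (\<forall>A\<in>I. \<forall>B. B \<subseteq> A \<longrightarrow> B \<in> I) \<and>
     (\<forall>A\<in>I. \<forall>B\<in>I. A \<union> B \<in> I) \<and>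
     (\<forall>F. finite F \<and> F \<subseteq> X \<longrightarrow> F \<in> I) \<and>
     X \<notin> I"

definition ideal_restr :: "'a set set \<Rightarrow> 'a set \<Rightarrow> 'a set set" where
  "ideal_restr I C = {A \<inter> C | A. A \<in> I}"

definition D_ideal :: "'a set set \<Rightarrow> ('a \<Rightarrow> nat) set" where
  "D_ideal I = {f. (\<forall>x. x \<notin> \<Union>I \<longrightarrow> f x = undefined) \<and>
                   (\<forall>n. {x \<in> \<Union>I. f x = n} \<in> I)}"

definition omega_diag_univ :: "'a set \<Rightarrow> 'a set set \<Rightarrow> bool" where
  "omega_diag_univ X J \<longleftrightarrow> (\<exists>\<Z> :: nat \<Rightarrow> 'a set set.
     (\<forall>k. \<Z> k \<subseteq> {Z. finite Z \<and> Z \<subseteq> X \<and> Z \<noteq> {}}) \<and>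
     (\<forall>k. \<forall>A\<in>J. \<exists>Z\<in>\<Z> k. Z \<inter> A = {}) \<and>
     (\<forall>A\<in>J. \<exists>k. \<forall>Z\<in>\<Z> k. \<not> Z \<subseteq> A))"

definition strongly_unboring :: "'a set set \<Rightarrow> bool" where
  "strongly_unboring I \<longleftrightarrow> (\<forall>f\<in>D_ideal I. \<exists>C. C \<subseteq> \<Union>I \<and> C \<notin> I \<and>
      (\<forall>n. finite {x \<in> C. f x = n}) \<and> omega_diag_univ C (ideal_restr I C))"

definition FinBW :: "'a set set \<Rightarrow> 'b topology \<Rightarrow> bool" where
  "FinBW I T \<longleftrightarrow> Hausdorff_space T \<and>
     (\<forall>x :: 'a \<Rightarrow> 'b. (\<forall>n\<in>\<Union>I. x n \<in> topspace T) \<longrightarrow>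
        (\<exists>A. A \<subseteq> \<Union>I \<and> A \<notin> I \<and> (\<exists>L\<in>topspace T.
           \<forall>U. openin T U \<and> L \<in> U \<longrightarrow> finite {n \<in> A. x n \<notin> U})))"

datatype mpoint = MNat nat | MSet "nat set" | MInf

definition almost_disjoint_family :: "nat set set \<Rightarrow> bool" where
  "almost_disjoint_family \<A> \<longleftrightarrow> infinite \<A> \<and> (\<forall>A\<in>\<A>. infinite A) \<and>
     (\<forall>A\<in>\<A>. \<forall>B\<in>\<A>. A \<noteq> B \<longrightarrow> finite (A \<inter> B))"

definition mrowka_basis :: "nat set set \<Rightarrow> mpoint set set" where
  "mrowka_basis \<A> =
     {{MNat n} | n. True}
   \<union> {insert (MSet A) (MNat ` (A - F)) | A F. A \<in> \<A> \<and> finite F}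
   \<union> {insert MInf (MSet ` (\<A> - G) \<union> MNat ` (UNIV - (F \<union> \<Union>G))) | F G.
        finite F \<and> finite G \<and> G \<subseteq> \<A>}"

definition Mrowka :: "nat set set \<Rightarrow> mpoint topology" where
  "Mrowka \<A> = topology_generated_by (mrowka_basis \<A>)"

end

theory Submission
  imports Defs
begin

text \<open>
  Well-order all pairs \<open>(C, g)\<close> with \<open>C \<subseteq> X\<close> and \<open>g : C \<rightarrow> \<omega>\<close> in type continuum, and build
  \<open>\<A>\<close> recursively, adding one set \<open>B\<close> per pair.  Suppose \<open>g\<close> is finite-to-one on \<open>C \<notin> I\<close>,
  where \<open>I|C\<close> is diagonalized by \<open>\<Z>\<close>.  If some earlier \<open>A\<close> has \<open>g\<inverse>[A] \<notin> I\<close>, then \<open>g\<close> already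
  converges to the point \<open>A\<close> along a set outside \<open>I\<close>, and \<open>B\<close> is any infinite set almost disjoint
  from the earlier ones.  Otherwise the fewer than continuum many sets \<open>g\<inverse>[A]\<close> lie in \<open>I\<close>, and
  MA for the Mathias-like poset of pairs (finite approximation, promise to avoid a set of the
  ideal) yields \<open>D \<subseteq> C\<close> almost disjoint from all of them and containing a member of every
  \<open>\<Z> k\<close>, hence outside \<open>I\<close>; put \<open>B = g[D]\<close>.
  A sequence in the resulting space is constant on a set outside \<open>I\<close>, or else it is finite-to-one
  on a set \<open>C\<close> as in the definition of strong unboringness; it then converges to \<open>\<infinity>\<close> on the part
  with values outside \<open>\<omega>\<close>, while the part with values in \<open>\<omega>\<close> is one of the pairs \<open>(C, g)\<close>.
\<close>

section \<open>Cardinality below the continuum\<close>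

text \<open>The size bound from \<open>MA_sigma_centered\<close>, made available for sets of any
  type, so that a family can be counted before it is turned into a family of dense sets.\<close>

definition below_continuum :: "'b set \<Rightarrow> bool" where
  "below_continuum F \<longleftrightarrow> (card_of F, card_of (UNIV :: real set)) \<in> ordLess"

lemma below_continuum_countable:
  assumes "countable F"
  shows "below_continuum F"
proof -
  have "(card_of (UNIV :: real set), card_of F) \<notin> ordLeq"
  proof
    assume "(card_of (UNIV :: real set), card_of F) \<in> ordLeq"
    then obtain f :: "real \<Rightarrow> 'a" where "inj_on f UNIV" "f ` UNIV \<subseteq> F"
      unfolding card_of_ordLeq[symmetric] by blast
    then have "countable (UNIV :: real set)"
      using assms countable_image_inj_on countable_subset by metis
    then show False using uncountable_UNIV_real by simp
  qed
  then show ?thesis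
    unfolding below_continuum_def by (simp add: card_of_Well_order not_ordLeq_iff_ordLess)
qed

lemma below_continuum_image:
  "below_continuum F \<Longrightarrow> below_continuum (h ` F)"
  unfolding below_continuum_def by (rule ordLeq_ordLess_trans[OF card_of_image])

lemma below_continuum_Un:
  "below_continuum F \<Longrightarrow> below_continuum G \<Longrightarrow> below_continuum (F \<union> G)"
  unfolding below_continuum_def
  by (rule card_of_Un_ordLess_infinite) (use infinite_UNIV_char_0 in auto)

lemma uncountable_UNIV_nat_set: "uncountable (UNIV :: nat set set)"
  using countable_eqpoll[OF _ eqpoll_sym[OF nat_sets_eqpoll_reals]] uncountable_UNIV_real by blast

text \<open>\<open>card_of\<close> is a well-order of minimal length, so each of its proper initial
  segments is strictly smaller than the whole. This bounds the number of sets built before a given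
  stage of the recursion.\<close>

lemma below_continuum_underS:
  "below_continuum (underS (card_of (UNIV :: nat set set)) S)"
proof -
  have "(card_of (UNIV :: nat set set), card_of (UNIV :: real set)) \<in> ordIso"
    using nat_sets_eqpoll_reals unfolding eqpoll_def card_of_ordIso[symmetric] .
  moreover have "(card_of (underS (card_of (UNIV :: nat set set)) S), card_of (UNIV :: nat set set)) \<in> ordLess"
    by (rule card_of_underS) (simp_all add: card_of_card_order_on Field_card_of)
  ultimately show ?thesis
    unfolding below_continuum_def using ordLess_ordIso_trans by blast
qed

section \<open>The consequence of Martin's axiom\<close>

text \<open>A condition is a finite stem together with a promise from \<open>\<U>\<close> that later
  points of the stem avoid. The set \<open>D\<close> is the union of the stems in a sufficiently
  generic filter. Asking \<open>\<U>\<close> only to contain the empty set and be closed under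
  unions lets the lemma serve both for a restricted ideal and for the finite unions of an almost
  disjoint family.\<close>

lemma MA_almost_disjoint_set:
  fixes X :: "'a set" and \<Z> :: "nat \<Rightarrow> 'a set set"
  assumes MA: MA_sigma_centered
    and X: "countable X"
    and UX: "\<And>U. U \<in> \<U> \<Longrightarrow> U \<subseteq> X"
    and U0: "{} \<in> \<U>"
    and Un: "\<And>U V. U \<in> \<U> \<Longrightarrow> V \<in> \<U> \<Longrightarrow> U \<union> V \<in> \<U>"
    and Z: "\<And>U k. U \<in> \<U> \<Longrightarrow> \<exists>Z\<in>\<Z> k. finite Z \<and> Z \<subseteq> X \<and> Z \<inter> U = {}"
    and F: "F \<subseteq> \<U>" "below_continuum F"
  shows "\<exists>D\<subseteq>X. (\<forall>A\<in>F. finite (D \<inter> A)) \<and> (\<forall>k. \<exists>Z\<in>\<Z> k. Z \<subseteq> D)"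
proof -
  define e where "e = to_nat_on X"
  have e: "e x = e y \<longleftrightarrow> x = y" if "x \<in> X" "y \<in> X" for x y
    using that X inj_on_to_nat_on unfolding e_def by (metis inj_on_def)
  \<comment> \<open>A condition \<open>(s, U)\<close> is coded by a single set of naturals, \<open>s\<close> on the even and \<open>U\<close> on the odd numbers.\<close>
  define st where "st S = {x\<in>X. 2 * e x \<in> S}" for S :: "nat set"
  define un where "un S = {x\<in>X. 2 * e x + 1 \<in> S}" for S :: "nat set"
  define enc where "enc s U = (\<lambda>x. 2 * e x) ` s \<union> (\<lambda>x. 2 * e x + 1) ` U" for s U
  have neq: "2 * a \<noteq> Suc (2 * b)" for a b :: nat by presburger
  have st_enc: "st (enc s U) = s" and un_enc: "un (enc s U) = U" if "s \<subseteq> X" "U \<subseteq> X" for s U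
    using that e neq neq[symmetric] unfolding st_def un_def enc_def by (auto simp: subset_iff)
  define P where "P = {S. finite (st S) \<and> un S \<in> \<U>}"
  \<comment> \<open>The Mathias order: a stronger condition extends stem and promise, and no new
    point of the stem lies in the old promise.\<close>
  define le where "le S T \<longleftrightarrow> st T \<subseteq> st S \<and> un T \<subseteq> un S \<and> (st S - st T) \<inter> un T = {}" for S T
  have enc_P: "enc s U \<in> P" if "finite s" "s \<subseteq> X" "U \<in> \<U>" for s U
    using that UX by (simp add: P_def st_enc un_enc)
  have stX: "st S \<subseteq> X" for S by (auto simp: st_def)
  have poset: "forcing_poset P le"
    unfolding forcing_poset_def
  proof (intro conjI)
    show "P \<noteq> {}" using enc_P[of "{}" "{}"] U0 by auto
  qed (auto simp: le_def)
  have fin_Union: "\<Union>(un ` H) \<in> \<U>" if "finite H" "H \<subseteq> P" for H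
    using that by (induction H) (auto simp: U0 Un P_def)
  \<comment> \<open>The centered pieces are indexed by stems, of which there are countably many.
    Finitely many conditions with the same stem have a lower bound that keeps this stem and joins
    the promises; no point is added, so no promise is broken.\<close>
  define s where "s = from_nat_into {s. finite s \<and> s \<subseteq> X}"
  have s: "\<exists>n. s n = t" if "finite t" "t \<subseteq> X" for t
    using that from_nat_into_surj[OF countable_Collect_finite_subset[OF X], of t] by (simp add: s_def)
  have sc: "sigma_centered P le"
    unfolding sigma_centered_def
  proof (intro exI conjI allI)
    show "P = (\<Union>n. {S \<in> P. st S = s n})"
      using s stX by (fastforce simp: P_def)
    fix n
    show "centered_in P le {S \<in> P. st S = s n}"
      unfolding centered_in_def
    proof (intro conjI allI impI)
      fix H assume H: "finite H \<and> H \<subseteq> {S \<in> P. st S = s n}"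
      show "\<exists>r\<in>P. \<forall>q\<in>H. le r q"
      proof (cases "H = {}")
        case True
        then show ?thesis using poset by (auto simp: forcing_poset_def)
      next
        case False
        then obtain T where "T \<in> H" by auto
        with H have sn: "finite (s n)" "s n \<subseteq> X" using stX[of T] by (auto simp: P_def)
        have U: "\<Union>(un ` H) \<in> \<U>" using H by (intro fin_Union) auto
        have "le (enc (s n) (\<Union>(un ` H))) q" if "q \<in> H" for q
          using that H sn UX[OF U] by (auto simp: le_def st_enc un_enc)
        then show ?thesis using enc_P[OF sn U] by blast
      qed
    qed auto
  qed
  \<comment> \<open>Meeting \<open>DA A\<close> makes the filter promise to avoid \<open>A\<close>
    from some condition on; meeting \<open>DZ k\<close> puts a whole member of \<open>\<Z> k\<close>
    into a stem.\<close>
  define DA where "DA A = {S \<in> P. A \<subseteq> un S}" for A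
  define DZ where "DZ k = {S \<in> P. \<exists>Z\<in>\<Z> k. Z \<subseteq> st S}" for k
  have dA: "dense_in P le (DA A)" if "A \<in> F" for A
    unfolding dense_in_def
  proof (intro conjI ballI)
    fix p assume p: "p \<in> P"
    then have U: "un p \<union> A \<in> \<U>" and fin: "finite (st p)" using that F Un by (auto simp: P_def)
    show "\<exists>d\<in>DA A. le d p"
      using enc_P[OF fin stX U] UX[OF U]
      by (intro bexI[of _ "enc (st p) (un p \<union> A)"]) (auto simp: DA_def le_def st_enc un_enc stX)
  qed (auto simp: DA_def)
  have dZ: "dense_in P le (DZ k)" for k
    unfolding dense_in_def
  proof (intro conjI ballI)
    fix p assume p: "p \<in> P"
    then have U: "un p \<in> \<U>" and fin: "finite (st p)" by (auto simp: P_def)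
    \<comment> \<open>The existing promise \<open>un p\<close> cannot block the extension, since
      some member of \<open>\<Z> k\<close> is disjoint from it.\<close>
    obtain Z where Z: "Z \<in> \<Z> k" "finite Z" "Z \<subseteq> X" "Z \<inter> un p = {}" using Z[OF U] by blast
    have "enc (st p \<union> Z) (un p) \<in> P" using fin Z stX U by (intro enc_P) auto
    then show "\<exists>d\<in>DZ k. le d p"
      using Z UX[OF U] stX
      by (intro bexI[of _ "enc (st p \<union> Z) (un p)"]) (auto simp: DZ_def le_def st_enc un_enc)
  qed (auto simp: DZ_def)
  have "below_continuum (DA ` F \<union> range DZ)"
    by (intro below_continuum_Un below_continuum_image F below_continuum_countable) auto
  moreover have "\<forall>D\<in>DA ` F \<union> range DZ. dense_in P le D" using dA dZ by auto
  ultimately obtain G where G: "filter_in P le G" "\<forall>D\<in>DA ` F \<union> range DZ. G \<inter> D \<noteq> {}"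
    using MA[unfolded MA_sigma_centered_def, rule_format, OF conjI[OF poset sc] conjI]
    unfolding below_continuum_def by metis
  define D where "D = \<Union>(st ` G)"
  have "finite (D \<inter> A)" if "A \<in> F" for A
  proof -
    have "G \<inter> DA A \<noteq> {}" using G(2) that by blast
    then obtain S where S: "S \<in> G" "S \<in> P" "A \<subseteq> un S" unfolding DA_def by blast
    \<comment> \<open>\<open>S\<close> has promised to avoid \<open>A\<close>. A point of
      \<open>A\<close> in another stem \<open>st T\<close> is also in the stem of a common extension
      \<open>R\<close>, so it must have been in \<open>st S\<close> already.\<close>
    have "D \<inter> A \<subseteq> st S"
    proof
      fix x assume x: "x \<in> D \<inter> A"
      then obtain T where T: "T \<in> G" "x \<in> st T" by (auto simp: D_def)
      then obtain R where "le R S" "le R T" using G(1) S unfolding filter_in_def by blast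
      then show "x \<in> st S" using x S T unfolding le_def by blast
    qed
    then show ?thesis using S finite_subset by (auto simp: P_def)
  qed
  moreover have "\<exists>Z\<in>\<Z> k. Z \<subseteq> D" for k
  proof -
    obtain S where "S \<in> G" "S \<in> DZ k" using G(2) by blast
    then show ?thesis unfolding DZ_def D_def by blast
  qed
  moreover have "D \<subseteq> X" using stX by (auto simp: D_def)
  ultimately show ?thesis by blast
qed

lemma ideal_restr_iff:
  assumes "\<And>A B. A \<in> I \<Longrightarrow> B \<subseteq> A \<Longrightarrow> B \<in> I"
  shows "A \<in> ideal_restr I C \<longleftrightarrow> A \<in> I \<and> A \<subseteq> C"
proof
  assume "A \<in> ideal_restr I C"
  then obtain B where "B \<in> I" "A = B \<inter> C" unfolding ideal_restr_def by blast
  then show "A \<in> I \<and> A \<subseteq> C" using assms[of B A] by simp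
next
  assume "A \<in> I \<and> A \<subseteq> C"
  then show "A \<in> ideal_restr I C"
    unfolding ideal_restr_def by (intro CollectI exI[of _ A]) auto
qed

text \<open>The forcing lemma is applied to the restricted ideal. The first diagonalization clause
  provides the finite sets avoiding a promise; by the second, a set containing a member of every
  \<open>\<Z> k\<close> cannot belong to \<open>I\<close>.\<close>

lemma MA_omega_diag_almost_disjoint_set:
  fixes C :: "'a set"
  assumes MA: MA_sigma_centered
    and C: "countable C"
    and I: "{} \<in> I" "\<And>A B. A \<in> I \<Longrightarrow> B \<subseteq> A \<Longrightarrow> B \<in> I" "\<And>A B. A \<in> I \<Longrightarrow> B \<in> I \<Longrightarrow> A \<union> B \<in> I"
    and diag: "omega_diag_univ C (ideal_restr I C)"
    and F: "F \<subseteq> I" "\<And>A. A \<in> F \<Longrightarrow> A \<subseteq> C" "below_continuum F"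
  shows "\<exists>D\<subseteq>C. D \<notin> I \<and> (\<forall>A\<in>F. finite (D \<inter> A))"
proof -
  obtain \<Z> :: "nat \<Rightarrow> 'a set set" where "\<forall>k. \<Z> k \<subseteq> {Z. finite Z \<and> Z \<subseteq> C \<and> Z \<noteq> {}}"
    "\<forall>k. \<forall>A\<in>ideal_restr I C. \<exists>Z\<in>\<Z> k. Z \<inter> A = {}"
    "\<forall>A\<in>ideal_restr I C. \<exists>k. \<forall>Z\<in>\<Z> k. \<not> Z \<subseteq> A"
    using diag unfolding omega_diag_univ_def by (elim exE conjE)
  note Z = this[rule_format]
  have J: "A \<in> ideal_restr I C \<longleftrightarrow> A \<in> I \<and> A \<subseteq> C" for A
    by (rule ideal_restr_iff) (rule I(2))
  have "\<exists>D\<subseteq>C. (\<forall>A\<in>F. finite (D \<inter> A)) \<and> (\<forall>k. \<exists>Z\<in>\<Z> k. Z \<subseteq> D)"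
  proof (rule MA_almost_disjoint_set[OF MA C, where \<U> = "ideal_restr I C"])
    show "\<exists>Z\<in>\<Z> k. finite Z \<and> Z \<subseteq> C \<and> Z \<inter> U = {}" if "U \<in> ideal_restr I C" for U k
      using Z(1)[of k] Z(2)[OF that, of k] by blast
  qed (use F I(1,3) in \<open>auto simp: J\<close>)
  then obtain D where D: "D \<subseteq> C" "\<forall>A\<in>F. finite (D \<inter> A)" "\<forall>k. \<exists>Z\<in>\<Z> k. Z \<subseteq> D" by blast
  have "D \<notin> I"
  proof
    assume "D \<in> I"
    then obtain k where "\<forall>Z\<in>\<Z> k. \<not> Z \<subseteq> D" using Z(3)[of D] D(1) by (auto simp: J)
    with D(3) show False by metis
  qed
  with D show ?thesis by (intro exI[of _ D]) simp
qed

text \<open>Keep only the members of \<open>\<Z> k\<close> that miss \<open>B\<close>. The first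
  clause for \<open>A \<union> B\<close> in place of \<open>A\<close> shows that enough of them
  remain. This allows a negligible part of \<open>C\<close> to be discarded later.\<close>

lemma omega_diag_univ_Diff:
  fixes C :: "'a set"
  assumes I: "\<And>A B. A \<in> I \<Longrightarrow> B \<subseteq> A \<Longrightarrow> B \<in> I" "\<And>A B. A \<in> I \<Longrightarrow> B \<in> I \<Longrightarrow> A \<union> B \<in> I"
    and diag: "omega_diag_univ C (ideal_restr I C)"
    and B: "B \<in> I"
  shows "omega_diag_univ (C - B) (ideal_restr I (C - B))"
proof -
  obtain \<Z> :: "nat \<Rightarrow> 'a set set" where "\<forall>k. \<Z> k \<subseteq> {Z. finite Z \<and> Z \<subseteq> C \<and> Z \<noteq> {}}"
    "\<forall>k. \<forall>A\<in>ideal_restr I C. \<exists>Z\<in>\<Z> k. Z \<inter> A = {}"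
    "\<forall>A\<in>ideal_restr I C. \<exists>k. \<forall>Z\<in>\<Z> k. \<not> Z \<subseteq> A"
    using diag unfolding omega_diag_univ_def by (elim exE conjE)
  note Z = this[rule_format]
  have J: "A \<in> ideal_restr I E \<longleftrightarrow> A \<in> I \<and> A \<subseteq> E" for A E
    by (rule ideal_restr_iff) (rule I(1))
  show ?thesis
    unfolding omega_diag_univ_def
  proof (intro exI[of _ "\<lambda>k. {Z \<in> \<Z> k. Z \<inter> B = {}}"] conjI allI ballI)
    show "{Z \<in> \<Z> k. Z \<inter> B = {}} \<subseteq> {Z. finite Z \<and> Z \<subseteq> C - B \<and> Z \<noteq> {}}" for k
      using Z(1)[of k] by blast
  next
    fix k A assume "A \<in> ideal_restr I (C - B)"
    then have "A \<union> B \<in> I" using I(2)[OF _ B] by (simp add: J)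
    then have "(A \<union> B) \<inter> C \<in> ideal_restr I C" using I(1)[OF _ Int_lower1] by (simp add: J)
    then obtain Z where "Z \<in> \<Z> k" "Z \<inter> ((A \<union> B) \<inter> C) = {}" using Z(2) by blast
    moreover have "Z \<subseteq> C" using calculation Z(1)[of k] by blast
    ultimately show "\<exists>Z\<in>{Z \<in> \<Z> k. Z \<inter> B = {}}. Z \<inter> A = {}" by blast
  next
    fix A assume "A \<in> ideal_restr I (C - B)"
    then have "A \<in> ideal_restr I C" by (auto simp: J)
    then obtain k where "\<forall>Z\<in>\<Z> k. \<not> Z \<subseteq> A" using Z(3)[of A] by blast
    then show "\<exists>k. \<forall>Z\<in>{Z \<in> \<Z> k. Z \<inter> B = {}}. \<not> Z \<subseteq> A" by (intro exI[of _ k]) simp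
  qed
qed

section \<open>Extending almost disjoint families\<close>

lemma almost_disjoint_family_infinite_Diff_Union:
  assumes "almost_disjoint_family \<A>" "finite H" "A \<in> \<A>" "A \<notin> H" "H \<subseteq> \<A>"
  shows "infinite (A - \<Union>H)"
proof -
  have "finite (A \<inter> B)" if "B \<in> H" for B
  proof -
    have "B \<in> \<A>" "A \<noteq> B" using that assms(4,5) by auto
    then show ?thesis using assms(1,3) by (simp add: almost_disjoint_family_def)
  qed
  then have "finite (\<Union>B\<in>H. A \<inter> B)" using assms(2) by (intro finite_UN_I)
  moreover have "A - \<Union>H = A - (\<Union>B\<in>H. A \<inter> B)" by blast
  ultimately show ?thesis using assms by (simp add: almost_disjoint_family_def)
qed

text \<open>The same forcing with finite unions of members of \<open>\<A>\<close> as promises; the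
  singletons \<open>{n}\<close> with \<open>n \<ge> k\<close> play the role of \<open>\<Z> k\<close>
  and force \<open>D\<close> to be unbounded. It supplies a set at stages where nothing has to be
  served.\<close>

lemma MA_almost_disjoint_family_not_maximal:
  assumes MA: MA_sigma_centered and \<A>: "almost_disjoint_family \<A>" "below_continuum \<A>"
  shows "\<exists>B. infinite B \<and> (\<forall>A\<in>\<A>. finite (A \<inter> B))"
proof -
  have "\<exists>D\<subseteq>UNIV. (\<forall>A\<in>\<A>. finite (D \<inter> A)) \<and> (\<forall>k. \<exists>Z\<in>{{n} |n. k \<le> n}. Z \<subseteq> D)"
  proof (rule MA_almost_disjoint_set[OF MA, where \<U> = "{\<Union>H |H. finite H \<and> H \<subseteq> \<A>}"])
    show "{} \<in> {\<Union>H |H. finite H \<and> H \<subseteq> \<A>}" by (auto intro!: exI[of _ "{}"])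
    show "U \<union> V \<in> {\<Union>H |H. finite H \<and> H \<subseteq> \<A>}"
      if UV: "U \<in> {\<Union>H |H. finite H \<and> H \<subseteq> \<A>}" "V \<in> {\<Union>H |H. finite H \<and> H \<subseteq> \<A>}" for U V
    proof -
      obtain H K where "U = \<Union>H" "V = \<Union>K" "finite H" "finite K" "H \<subseteq> \<A>" "K \<subseteq> \<A>" using UV by blast
      then show ?thesis by (intro CollectI exI[of _ "H \<union> K"]) auto
    qed
    show "\<A> \<subseteq> {\<Union>H |H. finite H \<and> H \<subseteq> \<A>}"
    proof
      fix A assume "A \<in> \<A>"
      then show "A \<in> {\<Union>H |H. finite H \<and> H \<subseteq> \<A>}" by (intro CollectI exI[of _ "{A}"]) auto
    qed
    fix U and k :: nat assume "U \<in> {\<Union>H |H. finite H \<and> H \<subseteq> \<A>}"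
    then obtain H where H: "U = \<Union>H" "finite H" "H \<subseteq> \<A>" by blast
    have "infinite (\<A> - H)" using H \<A> by (simp add: almost_disjoint_family_def)
    then obtain A where "A \<in> \<A>" "A \<notin> H" using infinite_imp_nonempty by blast
    then have "infinite (A - \<Union>H)"
      using almost_disjoint_family_infinite_Diff_Union \<A> H by blast
    then obtain n where "n \<ge> k" "n \<in> A - \<Union>H" unfolding infinite_nat_iff_unbounded_le by blast
    then show "\<exists>Z\<in>{{n} |n. k \<le> n}. finite Z \<and> Z \<subseteq> UNIV \<and> Z \<inter> U = {}"
      using H by (intro bexI[of _ "{n}"]) auto
  qed (use \<A> in auto)
  then obtain D where D: "\<forall>A\<in>\<A>. finite (D \<inter> A)" "\<forall>k. \<exists>Z\<in>{{n} |n. k \<le> n}. Z \<subseteq> D"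
    by (elim exE conjE)
  have "\<exists>n\<ge>k. n \<in> D" for k using D(2)[rule_format, of k] by auto
  then have "infinite D" unfolding infinite_nat_iff_unbounded_le by blast
  moreover have "\<forall>A\<in>\<A>. finite (A \<inter> D)" using D(1) by (simp add: Int_commute)
  ultimately show ?thesis by blast
qed

text \<open>\<open>task I C g\<close>: some set added at this stage has to make \<open>g\<close> converge along a subset of \<open>C\<close>
  outside \<open>I\<close>; \<open>served I C g \<A>\<close>: some point of \<open>\<A>\<close> is such a limit.\<close>

definition task :: "'a set set \<Rightarrow> 'a set \<Rightarrow> ('a \<Rightarrow> nat) \<Rightarrow> bool" where
  "task I C g \<longleftrightarrow> C \<notin> I \<and> (\<forall>n. finite {x \<in> C. g x = n}) \<and> omega_diag_univ C (ideal_restr I C)"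

definition served :: "'a set set \<Rightarrow> 'a set \<Rightarrow> ('a \<Rightarrow> nat) \<Rightarrow> nat set set \<Rightarrow> bool" where
  "served I C g \<A> \<longleftrightarrow> (\<exists>A\<in>\<A>. \<exists>D\<subseteq>C. D \<notin> I \<and> g ` D \<subseteq> A)"

lemma MA_extend_almost_disjoint_family:
  assumes MA: MA_sigma_centered and \<A>: "almost_disjoint_family \<A>" "below_continuum \<A>"
    and X: "countable X" "C \<subseteq> X" and I: "is_ideal_on X I"
  shows "\<exists>B. infinite B \<and> (\<forall>A\<in>\<A>. finite (A \<inter> B)) \<and> (task I C g \<longrightarrow> served I C g (insert B \<A>))"
proof (cases "task I C g \<and> (\<forall>A\<in>\<A>. {x \<in> C. g x \<in> A} \<in> I)")
  \<comment> \<open>Either there is no task, or a member of \<open>\<A>\<close> with preimage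
    outside \<open>I\<close> serves it already; any new almost disjoint set will do.\<close>
  case False
  have *: "served I C g (insert B \<A>)" if "task I C g" for B
  proof -
    obtain A where A: "A \<in> \<A>" "{x \<in> C. g x \<in> A} \<notin> I" using False \<open>task I C g\<close> by blast
    then show ?thesis
      unfolding served_def by (intro bexI[of _ A] exI[of _ "{x \<in> C. g x \<in> A}"]) auto
  qed
  obtain B where "infinite B" "\<forall>A\<in>\<A>. finite (A \<inter> B)"
    using MA_almost_disjoint_family_not_maximal[OF MA \<A>] by blast
  with * show ?thesis by (intro exI[of _ B]) simp
next
  case True
  have ideal: "{} \<in> I" "\<And>A B. A \<in> I \<Longrightarrow> B \<subseteq> A \<Longrightarrow> B \<in> I" "\<And>A B. A \<in> I \<Longrightarrow> B \<in> I \<Longrightarrow> A \<union> B \<in> I"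
    using I unfolding is_ideal_on_def by simp_all
  \<comment> \<open>Almost disjointness is forced on the side of the index set \<open>C\<close>,
    from the preimages of the members of \<open>\<A>\<close>, and transferred to
    \<open>\<omega>\<close> by taking the image under \<open>g\<close>.\<close>
  have "\<exists>D\<subseteq>C. D \<notin> I \<and> (\<forall>A\<in>(\<lambda>A. {x \<in> C. g x \<in> A}) ` \<A>. finite (D \<inter> A))"
    by (rule MA_omega_diag_almost_disjoint_set[OF MA])
      (use True X ideal in \<open>auto simp: task_def intro: countable_subset below_continuum_image[OF \<A>(2)]\<close>)
  then obtain D where D: "D \<subseteq> C" "D \<notin> I" "\<And>A. A \<in> \<A> \<Longrightarrow> finite (D \<inter> {x \<in> C. g x \<in> A})"
    by auto
  have "D \<subseteq> X" using D(1) X(2) by (rule order_trans)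
  then have "infinite D" using D(2) I unfolding is_ideal_on_def by blast
  have "infinite (g ` D)"
  proof
    assume "finite (g ` D)"
    moreover have "finite {x \<in> D. g x = n}" for n
      using True D(1) by (auto simp: task_def intro: finite_subset[of _ "{x \<in> C. g x = n}"])
    ultimately have "finite (\<Union>n\<in>g ` D. {x \<in> D. g x = n})" by blast
    also have "(\<Union>n\<in>g ` D. {x \<in> D. g x = n}) = D" by auto
    finally have "finite D" .
    with \<open>infinite D\<close> show False by simp
  qed
  moreover have "finite (A \<inter> g ` D)" if "A \<in> \<A>" for A
    by (rule finite_subset[OF _ finite_imageI[OF D(3)[OF that], of g]]) (use D(1) in auto)
  moreover have "served I C g (insert (g ` D) \<A>)" using D(1,2) unfolding served_def by blast
  ultimately show ?thesis by (intro exI[of _ "g ` D"]) simp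
qed

section \<open>Transfinite recursion of length continuum\<close>

text \<open>The columns of the pairing function. They seed the recursion, so that the family is
  infinite at every stage, as \<open>almost_disjoint_family\<close> demands.\<close>

lemma almost_disjoint_partition:
  "almost_disjoint_family (range (\<lambda>n. range (\<lambda>m. prod_encode (n, m))))"
proof -
  have "inj (\<lambda>n. range (\<lambda>m. prod_encode (n, m)))"
  proof (rule injI)
    fix n k assume "range (\<lambda>m. prod_encode (n, m)) = range (\<lambda>m. prod_encode (k, m))"
    then have "prod_encode (n, 0) \<in> range (\<lambda>m. prod_encode (k, m))" by blast
    then show "n = k" by auto
  qed
  moreover have "infinite (range (\<lambda>m. prod_encode (n, m)))" for n
    by (rule range_inj_infinite) (auto simp: inj_on_def)
  moreover have "range (\<lambda>m. prod_encode (n, m)) \<inter> range (\<lambda>m. prod_encode (k, m)) = {}" if "n \<noteq> k" for n k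
    using that by auto
  ultimately show ?thesis
    unfolding almost_disjoint_family_def
    by (smt (verit, ccfv_threshold) finite.emptyI rangeE range_inj_infinite)
qed

text \<open>A pair \<open>(C, g)\<close> is coded by the graph of \<open>g\<close> on
  \<open>C\<close>, so that the recursion can run over the sets of naturals. Off \<open>C\<close>
  the decoded function is arbitrary; the congruence lemmas for \<open>task\<close> and
  \<open>served\<close> account for this.\<close>

lemma nat_set_codes:
  assumes "countable X"
  obtains dom :: "nat set \<Rightarrow> 'a set" and fn :: "nat set \<Rightarrow> 'a \<Rightarrow> nat"
  where "\<And>S. dom S \<subseteq> X" "\<And>C g. C \<subseteq> X \<Longrightarrow> \<exists>S. dom S = C \<and> (\<forall>x\<in>C. fn S x = g x)"
proof
  let ?e = "to_nat_on X"
  let ?dom = "\<lambda>S. {x \<in> X. \<exists>n. prod_encode (?e x, n) \<in> S}"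
  let ?fn = "\<lambda>S x. THE n. prod_encode (?e x, n) \<in> S"
  show "?dom S \<subseteq> X" for S by auto
  fix C and g :: "'a \<Rightarrow> nat" assume C: "C \<subseteq> X"
  have e: "?e x = ?e y \<longleftrightarrow> x = y" if "x \<in> X" "y \<in> X" for x y
    using that assms inj_on_to_nat_on by (metis inj_on_def)
  define S where "S = (\<lambda>x. prod_encode (?e x, g x)) ` C"
  have "?dom S = C" using C e by (auto simp: S_def)
  moreover have "prod_encode (?e x, n) \<in> S \<longleftrightarrow> n = g x" if "x \<in> C" for x n
    using C e that by (auto simp: S_def subset_iff)
  ultimately show "\<exists>S. ?dom S = C \<and> (\<forall>x\<in>C. ?fn S x = g x)" by (intro exI[of _ S]) auto
qed

lemma task_cong: "(\<And>x. x \<in> C \<Longrightarrow> g x = h x) \<Longrightarrow> task I C g \<longleftrightarrow> task I C h"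
  unfolding task_def by (simp cong: conj_cong)

lemma served_cong:
  assumes "\<And>x. x \<in> C \<Longrightarrow> g x = h x"
  shows "served I C g \<A> \<longleftrightarrow> served I C h \<A>"
proof -
  have "g ` D = h ` D" if "D \<subseteq> C" for D using that assms by (intro image_cong) auto
  then show ?thesis unfolding served_def by (metis (no_types, lifting))
qed

lemma MA_uncountable_family_serving_all_tasks:
  fixes X :: "'a set"
  assumes MA: MA_sigma_centered and X: "countable X" and I: "is_ideal_on X I"
  shows "\<exists>\<A>. almost_disjoint_family \<A> \<and> uncountable \<A> \<and>
    (\<forall>C g. C \<subseteq> X \<longrightarrow> task I C g \<longrightarrow> served I C g \<A>)"
proof -
  obtain dom :: "nat set \<Rightarrow> 'a set" and fn :: "nat set \<Rightarrow> 'a \<Rightarrow> nat"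
    where dom: "\<And>S. dom S \<subseteq> X"
      and code: "\<And>C g. C \<subseteq> X \<Longrightarrow> \<exists>S. dom S = C \<and> (\<forall>x\<in>C. fn S x = g x)"
    using nat_set_codes[OF X] by blast
  define r where "r = card_of (UNIV :: nat set set)"
  define \<P> where "\<P> = range (\<lambda>n. range (\<lambda>m. prod_encode (n, m)))"
  define prev where "prev f S = \<P> \<union> f ` underS r S" for f :: "nat set \<Rightarrow> nat set" and S
  \<comment> \<open>The requirement on the set \<open>B\<close> chosen at stage \<open>S\<close>; it
    refers to \<open>f\<close> only through the stages before \<open>S\<close>.\<close>
  define good where "good f S B \<longleftrightarrow> infinite B \<and> (\<forall>A\<in>prev f S. finite (A \<inter> B)) \<and>
    (task I (dom S) (fn S) \<longrightarrow> served I (dom S) (fn S) (insert B (prev f S)))" for f S B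
  have wo: "Well_order r" "Field r = UNIV" unfolding r_def using card_of_Well_order by (simp_all add: Field_card_of)
  have wf: "wf (r - Id)" using wo unfolding well_order_on_def by simp
  have underS: "underS r S = {T. (T, S) \<in> r - Id}" for S by (auto simp: underS_def)
  have tot: "T \<in> underS r S \<or> S \<in> underS r T" if "S \<noteq> T" for S T
    using wo that unfolding well_order_on_def linear_order_on_def total_on_def by (auto simp: underS_def)
  have \<P>: "almost_disjoint_family \<P>" unfolding \<P>_def by (rule almost_disjoint_partition)
  \<comment> \<open>For two stages, almost disjointness is read off at the later one. The set
    \<open>K\<close> is arbitrary because the claim is used for \<open>underS r S\<close> inside the
    recursion and for \<open>UNIV\<close> at its end.\<close>
  have adf: "almost_disjoint_family (\<P> \<union> f ` K)"
    if K: "\<And>S. S \<in> K \<Longrightarrow> good f S (f S)" for f :: "nat set \<Rightarrow> nat set" and K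
  proof -
    have 1: "finite (f S \<inter> f T)" if "S \<in> K" "T \<in> K" "f S \<noteq> f T" for S T
    proof -
      have "S \<noteq> T" using that by auto
      with tot[OF this] K[OF that(1)] K[OF that(2)] show ?thesis
        unfolding good_def prev_def by (auto simp: Int_commute)
    qed
    have 2: "finite (A \<inter> f S)" if "S \<in> K" "A \<in> \<P>" for S A
      using K[OF that(1)] that(2) unfolding good_def prev_def by auto
    have 3: "infinite (f S)" if "S \<in> K" for S using K[OF that] unfolding good_def by auto
    show ?thesis
      unfolding almost_disjoint_family_def
    proof (intro conjI ballI impI)
      show "infinite (\<P> \<union> f ` K)" using \<P> by (simp add: almost_disjoint_family_def)
      show "infinite A" if "A \<in> \<P> \<union> f ` K" for A
        using that \<P> 3 by (auto simp: almost_disjoint_family_def)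
      fix A B assume "A \<in> \<P> \<union> f ` K" "B \<in> \<P> \<union> f ` K" "A \<noteq> B"
      then show "finite (A \<inter> B)"
        using 1 2 \<P> by (auto simp: almost_disjoint_family_def Int_commute)
    qed
  qed
  \<comment> \<open>Well-founded choice asks for two things: \<open>good\<close> depends only on
    earlier values of \<open>f\<close>, and each stage admits a value when all earlier ones are
    good.\<close>
  have "\<exists>f. \<forall>S. good f S (f S)"
  proof (rule dependent_wf_choice[OF wf])
    fix f g :: "nat set \<Rightarrow> nat set" and S B assume "\<And>T. (T, S) \<in> r - Id \<Longrightarrow> f T = g T"
    then have "prev f S = prev g S" unfolding prev_def underS by (auto simp: image_iff)
    then show "good f S B = good g S B" by (simp add: good_def)
  next
    fix S and f :: "nat set \<Rightarrow> nat set" assume IH: "\<And>T. (T, S) \<in> r - Id \<Longrightarrow> good f T (f T)"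
    have "almost_disjoint_family (prev f S)"
      unfolding prev_def by (rule adf) (use IH underS in auto)
    moreover have "below_continuum (prev f S)"
      unfolding prev_def \<P>_def r_def
      by (intro below_continuum_Un below_continuum_image below_continuum_underS below_continuum_countable) auto
    ultimately show "\<exists>B. good f S B"
      unfolding good_def using MA_extend_almost_disjoint_family[OF MA _ _ X dom I] by blast
  qed
  then obtain f :: "nat set \<Rightarrow> nat set" where f: "\<And>S. good f S (f S)" by blast
  define \<A> where "\<A> = \<P> \<union> range f"
  \<comment> \<open>If two stages gave the same set, it would be almost disjoint from itself, hence
    finite.\<close>
  have "inj f"
  proof (rule injI, rule ccontr)
    fix S T assume "f S = f T" "S \<noteq> T"
    with tot[OF this(2)] f[of S] f[of T] show False
      unfolding good_def prev_def by (metis Int_absorb UnCI image_eqI)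
  qed
  then have "uncountable (range f)"
    using uncountable_UNIV_nat_set countable_image_inj_on by blast
  then have "uncountable \<A>" unfolding \<A>_def by (simp add: countable_Un_iff)
  moreover have "almost_disjoint_family \<A>" unfolding \<A>_def using adf[of UNIV] f by auto
  moreover have "served I C g \<A>" if "C \<subseteq> X" "task I C g" for C g
  proof -
    obtain S where S: "dom S = C" "\<And>x. x \<in> C \<Longrightarrow> fn S x = g x" using code[OF \<open>C \<subseteq> X\<close>] by blast
    then have "task I (dom S) (fn S)" using that task_cong[of C "fn S" g] by simp
    then have "served I (dom S) (fn S) (insert (f S) (prev f S))" using f by (simp add: good_def)
    then have "served I C g (insert (f S) (prev f S))" using S served_cong[of C "fn S" g] by simp
    moreover have "insert (f S) (prev f S) \<subseteq> \<A>" unfolding \<A>_def prev_def by auto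
    ultimately show ?thesis unfolding served_def by blast
  qed
  ultimately show ?thesis by blast
qed

section \<open>Mrowka spaces\<close>

lemma topspace_Mrowka: "topspace (Mrowka \<A>) = range MNat \<union> MSet ` \<A> \<union> {MInf}"
proof -
  have "{MNat n} \<in> mrowka_basis \<A>" for n unfolding mrowka_basis_def by blast
  moreover have "insert (MSet A) (MNat ` (A - {})) \<in> mrowka_basis \<A>" if "A \<in> \<A>" for A
    unfolding mrowka_basis_def using that by blast
  moreover have "insert MInf (MSet ` (\<A> - {}) \<union> MNat ` (UNIV - ({} \<union> \<Union>{}))) \<in> mrowka_basis \<A>"
    unfolding mrowka_basis_def by blast
  moreover have "\<Union>(mrowka_basis \<A>) \<subseteq> range MNat \<union> MSet ` \<A> \<union> {MInf}"
    unfolding mrowka_basis_def by auto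
  ultimately show ?thesis
    unfolding Mrowka_def topology_generated_by_topspace by blast
qed

lemma openin_Mrowka_MNat: "openin (Mrowka \<A>) {MNat n}"
  unfolding Mrowka_def by (rule topology_generated_by_Basis) (auto simp: mrowka_basis_def)

lemma openin_Mrowka_MSet:
  "A \<in> \<A> \<Longrightarrow> finite F \<Longrightarrow> openin (Mrowka \<A>) (insert (MSet A) (MNat ` (A - F)))"
  unfolding Mrowka_def by (rule topology_generated_by_Basis) (auto simp: mrowka_basis_def)

lemma openin_Mrowka_MInf:
  "finite F \<Longrightarrow> finite G \<Longrightarrow> G \<subseteq> \<A> \<Longrightarrow>
    openin (Mrowka \<A>) (insert MInf (MSet ` (\<A> - G) \<union> MNat ` (UNIV - (F \<union> \<Union>G))))"
  unfolding Mrowka_def by (rule topology_generated_by_Basis) (unfold mrowka_basis_def, blast)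

text \<open>Induction on the generation of \<open>U\<close>: both properties survive finite
  intersections and arbitrary unions. They are what the convergence arguments use about
  neighbourhoods of \<open>A\<close> and of \<open>\<infinity>\<close>.\<close>

lemma openin_Mrowka_neighbourhoods:
  assumes "almost_disjoint_family \<A>" "openin (Mrowka \<A>) U"
  shows "(\<forall>A\<in>\<A>. MSet A \<in> U \<longrightarrow> finite {n \<in> A. MNat n \<notin> U}) \<and>
    (MInf \<in> U \<longrightarrow> finite {A \<in> \<A>. MSet A \<notin> U})"
proof -
  have "generate_topology_on (mrowka_basis \<A>) U"
    using assms(2) unfolding Mrowka_def by (rule openin_topology_generated_by)
  then show ?thesis
  proof induction
    case Empty
    then show ?case by simp
  next
    case (Int a b)
    have "{n \<in> A. MNat n \<notin> a \<inter> b} = {n \<in> A. MNat n \<notin> a} \<union> {n \<in> A. MNat n \<notin> b}"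
      "{A \<in> \<A>. MSet A \<notin> a \<inter> b} = {A \<in> \<A>. MSet A \<notin> a} \<union> {A \<in> \<A>. MSet A \<notin> b}" for A
      by auto
    then show ?case using Int by auto
  next
    case (UN K)
    show ?case
    proof (intro conjI ballI impI)
      fix A assume "A \<in> \<A>" "MSet A \<in> \<Union>K"
      then obtain k where "k \<in> K" "finite {n \<in> A. MNat n \<notin> k}" using UN by blast
      then show "finite {n \<in> A. MNat n \<notin> \<Union>K}" by (auto elim!: rev_finite_subset)
    next
      assume "MInf \<in> \<Union>K"
      then obtain k where "k \<in> K" "finite {A \<in> \<A>. MSet A \<notin> k}" using UN by blast
      then show "finite {A \<in> \<A>. MSet A \<notin> \<Union>K}" by (auto elim!: rev_finite_subset)
    qed
  next
    case (Basis s)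
    then consider n where "s = {MNat n}"
      | A F where "s = insert (MSet A) (MNat ` (A - F))" "finite F"
      | F G where "s = insert MInf (MSet ` (\<A> - G) \<union> MNat ` (UNIV - (F \<union> \<Union>G)))"
          "finite F" "finite G" "G \<subseteq> \<A>"
      unfolding mrowka_basis_def by (elim UnE CollectE exE conjE)
    then show ?case
    proof cases
      case 1
      then show ?thesis by auto
    next
      case 2
      then show ?thesis by (auto simp: image_iff elim!: rev_finite_subset)
    next
      case 3
      \<comment> \<open>The only case that uses almost disjointness: \<open>A\<close> is not in
        \<open>G\<close>, so a basic neighbourhood of \<open>\<infinity>\<close> loses only
        \<open>F\<close> and the finite sets \<open>A \<inter> B\<close> with
        \<open>B \<in> G\<close>.\<close>
      have "finite {n \<in> A. MNat n \<notin> s}" if "A \<in> \<A>" "MSet A \<in> s" for A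
      proof -
        have "finite (A \<inter> B)" if "B \<in> G" for B
        proof -
          have "A \<noteq> B" "B \<in> \<A>" using that 3 \<open>MSet A \<in> s\<close> by auto
          with assms(1) \<open>A \<in> \<A>\<close> show ?thesis by (auto simp: almost_disjoint_family_def)
        qed
        then have "finite (F \<union> (\<Union>B\<in>G. A \<inter> B))" using 3(2,3) by (intro finite_UnI finite_UN_I)
        then show ?thesis by (rule rev_finite_subset) (use 3 in auto)
      qed
      moreover have "finite {A \<in> \<A>. MSet A \<notin> s}"
        using 3(3) by (rule rev_finite_subset) (use 3 in auto)
      ultimately show ?thesis by blast
    qed
  qed
qed

text \<open>Each kind of pair is separated by explicit basic neighbourhoods. For two members of
  \<open>\<A>\<close>, their finite intersection is removed on one side.\<close>

lemma Hausdorff_space_Mrowka: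
  assumes "almost_disjoint_family \<A>"
  shows "Hausdorff_space (Mrowka \<A>)"
proof -
  define sep where "sep p q \<longleftrightarrow> (\<exists>U V. openin (Mrowka \<A>) U \<and> openin (Mrowka \<A>) V \<and>
    p \<in> U \<and> q \<in> V \<and> disjnt U V)" for p q
  have sym: "sep p q \<Longrightarrow> sep q p" for p q unfolding sep_def using disjnt_sym by blast
  have nn: "sep (MNat n) (MNat m)" if "n \<noteq> m" for n m
    unfolding sep_def using openin_Mrowka_MNat[of \<A>] that
    by (intro exI[of _ "{MNat n}"] exI[of _ "{MNat m}"]) auto
  have nA: "sep (MNat n) (MSet A)" if "A \<in> \<A>" for n A
    unfolding sep_def using openin_Mrowka_MNat[of \<A>] openin_Mrowka_MSet[OF that, of "{n}"]
    by (intro exI[of _ "{MNat n}"] exI[of _ "insert (MSet A) (MNat ` (A - {n}))"]) (auto simp: disjnt_iff)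
  have ni: "sep (MNat n) MInf" for n
    unfolding sep_def using openin_Mrowka_MNat[of \<A>] openin_Mrowka_MInf[of "{n}" "{}" \<A>]
    by (intro exI[of _ "{MNat n}"] exI[of _ "insert MInf (MSet ` (\<A> - {}) \<union> MNat ` (UNIV - ({n} \<union> \<Union>{})))"])
      (auto simp: disjnt_iff)
  have AB: "sep (MSet A) (MSet B)" if "A \<in> \<A>" "B \<in> \<A>" "A \<noteq> B" for A B
  proof -
    have "finite (A \<inter> B)" using that assms by (auto simp: almost_disjoint_family_def)
    then show ?thesis
      unfolding sep_def using openin_Mrowka_MSet[OF that(1)] openin_Mrowka_MSet[OF that(2), of "{}"] that
      by (intro exI[of _ "insert (MSet A) (MNat ` (A - (A \<inter> B)))"] exI[of _ "insert (MSet B) (MNat ` (B - {}))"])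
        (auto simp: disjnt_iff)
  qed
  have Ai: "sep (MSet A) MInf" if "A \<in> \<A>" for A
    unfolding sep_def using openin_Mrowka_MSet[OF that, of "{}"] openin_Mrowka_MInf[of "{}" "{A}" \<A>] that
    by (intro exI[of _ "insert (MSet A) (MNat ` (A - {}))"]
        exI[of _ "insert MInf (MSet ` (\<A> - {A}) \<union> MNat ` (UNIV - ({} \<union> \<Union>{A})))"]) (auto simp: disjnt_iff)
  have "sep p q" if "p \<in> topspace (Mrowka \<A>)" "q \<in> topspace (Mrowka \<A>)" "p \<noteq> q" for p q
    using that by (cases p; cases q)
      (simp_all add: topspace_Mrowka image_iff nn nA ni AB Ai sym[OF nA] sym[OF ni] sym[OF Ai])
  then show ?thesis unfolding Hausdorff_space_def sep_def by blast
qed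

text \<open>The isolated points are dense: an open set around \<open>\<infinity>\<close> contains
  some \<open>MSet A\<close>, since \<open>\<A>\<close> is infinite, and an open set around
  \<open>MSet A\<close> contains points of the infinite set \<open>A\<close>.\<close>

lemma separable_space_Mrowka:
  assumes ad: "almost_disjoint_family \<A>"
  shows "separable_space (Mrowka \<A>)"
proof -
  have A: "\<exists>n. MNat n \<in> U" if "openin (Mrowka \<A>) U" "A \<in> \<A>" "MSet A \<in> U" for U A
  proof -
    have "finite {n \<in> A. MNat n \<notin> U}" using openin_Mrowka_neighbourhoods[OF ad] that by blast
    moreover have "infinite A" using ad that by (auto simp: almost_disjoint_family_def)
    ultimately have "{n \<in> A. MNat n \<notin> U} \<noteq> A" by metis
    then show ?thesis by blast
  qed
  have i: "\<exists>n. MNat n \<in> U" if "openin (Mrowka \<A>) U" "MInf \<in> U" for U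
  proof -
    have "finite {A \<in> \<A>. MSet A \<notin> U}" using openin_Mrowka_neighbourhoods[OF ad] that by blast
    moreover have "infinite \<A>" using ad by (auto simp: almost_disjoint_family_def)
    ultimately have "{A \<in> \<A>. MSet A \<notin> U} \<noteq> \<A>" by metis
    then show ?thesis using A that(1) by blast
  qed
  have "Mrowka \<A> closure_of range MNat = topspace (Mrowka \<A>)"
  proof
    show "topspace (Mrowka \<A>) \<subseteq> Mrowka \<A> closure_of range MNat"
    proof
      fix p assume p: "p \<in> topspace (Mrowka \<A>)"
      have "\<exists>n. MNat n \<in> U" if "p \<in> U" "openin (Mrowka \<A>) U" for U
        using p that A i unfolding topspace_Mrowka by blast
      with p show "p \<in> Mrowka \<A> closure_of range MNat" by (auto simp: in_closure_of)
    qed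
  qed (rule closure_of_subset_topspace)
  then show ?thesis unfolding separable_space_def
    by (intro exI[of _ "range MNat"]) (auto simp: topspace_Mrowka)
qed

lemma uncountable_topspace_Mrowka:
  assumes "uncountable \<A>"
  shows "uncountable (topspace (Mrowka \<A>))"
proof
  assume "countable (topspace (Mrowka \<A>))"
  then have "countable (MSet ` \<A>)" by (rule countable_subset[rotated]) (auto simp: topspace_Mrowka)
  moreover have "inj_on MSet \<A>" by (auto simp: inj_on_def)
  ultimately show False using assms countable_image_inj_on by blast
qed

section \<open>Convergence of sequences along sets outside the ideal\<close>

lemma FinBW_Mrowka:
  fixes X :: "'a set"
  assumes X: "countable X" and I: "is_ideal_on X I" and su: "strongly_unboring I"
    and ad: "almost_disjoint_family \<A>"
    and served: "\<And>C g. C \<subseteq> X \<Longrightarrow> task I C g \<Longrightarrow> served I C g \<A>"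
  shows "FinBW I (Mrowka \<A>)"
proof -
  have IX: "A \<subseteq> X" if "A \<in> I" for A using that I by (auto simp: is_ideal_on_def)
  have sub: "B \<in> I" if "A \<in> I" "B \<subseteq> A" for A B using that I unfolding is_ideal_on_def by blast
  have un: "A \<union> B \<in> I" if "A \<in> I" "B \<in> I" for A B using that I unfolding is_ideal_on_def by blast
  have fin: "F \<in> I" if "finite F" "F \<subseteq> X" for F using that I unfolding is_ideal_on_def by blast
  have UI: "\<Union>I = X"
  proof
    show "X \<subseteq> \<Union>I"
    proof
      fix x assume "x \<in> X"
      then have "{x} \<in> I" by (intro fin) auto
      then show "x \<in> \<Union>I" by blast
    qed
  qed (use IX in auto)
  have "\<exists>A\<subseteq>X. A \<notin> I \<and> (\<exists>L\<in>topspace (Mrowka \<A>).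
      \<forall>U. openin (Mrowka \<A>) U \<and> L \<in> U \<longrightarrow> finite {n \<in> A. x n \<notin> U})"
    if x: "\<forall>n\<in>X. x n \<in> topspace (Mrowka \<A>)" for x :: "'a \<Rightarrow> mpoint"
  proof (cases "\<exists>p. {n \<in> X. x n = p} \<notin> I")
    case True
    then obtain p where p: "{n \<in> X. x n = p} \<notin> I" by blast
    moreover have "{} \<in> I" by (rule fin) simp_all
    ultimately have "{n \<in> X. x n = p} \<noteq> {}" by metis
    then have "p \<in> topspace (Mrowka \<A>)" using x by auto
    moreover have "finite {n \<in> {n \<in> X. x n = p}. x n \<notin> U}" if "p \<in> U" for U
    proof -
      have "{n \<in> {n \<in> X. x n = p}. x n \<notin> U} = {}" using that by auto
      then show ?thesis by (simp only: finite.emptyI)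
    qed
    ultimately show ?thesis using p
      by (intro exI[of _ "{n \<in> X. x n = p}"] conjI bexI[of _ p]) auto
  next
    case False
    then have fib: "{n \<in> X. x n = p} \<in> I" for p by blast
    define e where "e = to_nat_on (x ` X)"
    have e: "e p = e q \<longleftrightarrow> p = q" if "p \<in> x ` X" "q \<in> x ` X" for p q
      using that X inj_on_to_nat_on[of "x ` X"] unfolding e_def by (metis countable_image inj_on_def)
    \<comment> \<open>Strong unboringness speaks of functions into \<open>\<omega>\<close>, so the
      countably many values of \<open>x\<close> are numbered by \<open>e\<close>. The fibres of
      \<open>f\<close> are those of \<open>x\<close>; the value \<open>undefined\<close> outside
      \<open>X\<close> is what \<open>D_ideal\<close> prescribes.\<close>
    define f where "f n = (if n \<in> X then e (x n) else undefined)" for n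
    have "{n \<in> X. f n = m} \<in> I" for m
    proof (cases "\<exists>n\<in>X. f n = m")
      case True
      then obtain k where k: "k \<in> X" "f k = m" by blast
      have "{n \<in> X. f n = m} \<subseteq> {n \<in> X. x n = x k}" using k e by (auto simp: f_def)
      then show ?thesis using fib sub by blast
    next
      case False
      then have "{n \<in> X. f n = m} = {}" by auto
      moreover have "{} \<in> I" by (rule fin) simp_all
      ultimately show ?thesis by (simp only:)
    qed
    then have "f \<in> D_ideal I" by (auto simp: D_ideal_def UI f_def)
    then obtain C where C: "C \<subseteq> X" "C \<notin> I" "\<And>m. finite {n \<in> C. f n = m}"
      "omega_diag_univ C (ideal_restr I C)"
      using su unfolding strongly_unboring_def UI by blast
    have C_fib: "finite {n \<in> C. x n = p}" for p
      by (rule finite_subset[OF _ C(3)[of "e p"]]) (use C(1) in \<open>auto simp: f_def\<close>)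
    have C_fin: "finite {n \<in> C. x n \<in> Q}" if "finite Q" for Q
    proof -
      have "{n \<in> C. x n \<in> Q} = (\<Union>p\<in>Q. {n \<in> C. x n = p})" by auto
      then show ?thesis using that C_fib by simp
    qed
    define C1 where "C1 = {n \<in> C. x n \<notin> range MNat}"
    show ?thesis
    proof (cases "C1 \<in> I")
      case False
      \<comment> \<open>A neighbourhood of \<open>\<infinity>\<close> omits finitely many points
        \<open>MSet A\<close>, and \<open>x\<close> takes each of them finitely often on
        \<open>C\<close>.\<close>
      have "finite {n \<in> C1. x n \<notin> U}" if U: "openin (Mrowka \<A>) U" "MInf \<in> U" for U
      proof -
        have "finite (MSet ` {A \<in> \<A>. MSet A \<notin> U})"
          using openin_Mrowka_neighbourhoods[OF ad U(1)] U(2) by blast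
        then have "finite {n \<in> C. x n \<in> MSet ` {A \<in> \<A>. MSet A \<notin> U}}" by (rule C_fin)
        then show ?thesis
        proof (rule rev_finite_subset)
          show "{n \<in> C1. x n \<notin> U} \<subseteq> {n \<in> C. x n \<in> MSet ` {A \<in> \<A>. MSet A \<notin> U}}"
          proof
            fix n assume "n \<in> {n \<in> C1. x n \<notin> U}"
            then have n: "n \<in> C" "x n \<notin> range MNat" "x n \<notin> U" by (auto simp: C1_def)
            then have "x n \<in> topspace (Mrowka \<A>)" "x n \<noteq> MInf" using x C(1) U(2) by auto
            with n show "n \<in> {n \<in> C. x n \<in> MSet ` {A \<in> \<A>. MSet A \<notin> U}}"
              by (auto simp: topspace_Mrowka)
          qed
        qed
      qed
      moreover have "C1 \<subseteq> X" using C(1) by (auto simp: C1_def)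
      ultimately show ?thesis using False
        by (intro exI[of _ C1] conjI bexI[of _ MInf]) (auto simp: topspace_Mrowka)
    next
      case True
      \<comment> \<open>\<open>g\<close> reads off the natural number; the default 0 never occurs on
        \<open>C - C1\<close>, where all values of \<open>x\<close> are of the form
        \<open>MNat k\<close>.\<close>
      define g where "g n = (case x n of MNat k \<Rightarrow> k | _ \<Rightarrow> 0)" for n
      have g: "x n = MNat (g n)" if "n \<in> C - C1" for n
        using that by (auto simp: C1_def g_def)
      have "C - C1 \<notin> I"
      proof
        assume "C - C1 \<in> I"
        from un[OF this True] show False using C(2) sub[of "(C - C1) \<union> C1" C] by blast
      qed
      moreover have "finite {n \<in> C - C1. g n = m}" for m
        by (rule finite_subset[OF _ C_fib[of "MNat m"]]) (use g in auto)
      moreover have "omega_diag_univ (C - C1) (ideal_restr I (C - C1))"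
        using sub un C(4) True by (rule omega_diag_univ_Diff)
      ultimately have "task I (C - C1) g" by (simp add: task_def)
      then obtain A D where AD: "A \<in> \<A>" "D \<subseteq> C - C1" "D \<notin> I" "g ` D \<subseteq> A"
        using served[of "C - C1" g] C(1) unfolding served_def by blast
      \<comment> \<open>Along \<open>D\<close> the values lie in \<open>A\<close>. A neighbourhood
        of \<open>MSet A\<close> omits only finitely many points of \<open>A\<close>, each taken
        finitely often, so \<open>x\<close> converges to \<open>MSet A\<close>.\<close>
      have "finite {n \<in> D. x n \<notin> U}" if U: "openin (Mrowka \<A>) U" "MSet A \<in> U" for U
      proof -
        have "finite (MNat ` {k \<in> A. MNat k \<notin> U})"
          using openin_Mrowka_neighbourhoods[OF ad U(1)] U(2) AD by blast
        then have "finite {n \<in> C. x n \<in> MNat ` {k \<in> A. MNat k \<notin> U}}" by (rule C_fin)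
        then show ?thesis
        proof (rule rev_finite_subset)
          show "{n \<in> D. x n \<notin> U} \<subseteq> {n \<in> C. x n \<in> MNat ` {k \<in> A. MNat k \<notin> U}}"
          proof
            fix n assume n: "n \<in> {n \<in> D. x n \<notin> U}"
            then have "x n = MNat (g n)" "g n \<in> A" "n \<in> C" using AD g by auto
            with n show "n \<in> {n \<in> C. x n \<in> MNat ` {k \<in> A. MNat k \<notin> U}}" by auto
          qed
        qed
      qed
      moreover have "D \<subseteq> X" using AD C by auto
      ultimately show ?thesis using AD
        by (intro exI[of _ D] conjI bexI[of _ "MSet A"]) (auto simp: topspace_Mrowka)
    qed
  qed
  then show ?thesis unfolding FinBW_def UI using Hausdorff_space_Mrowka[OF ad] by blast
qed

theorem theorem5p6:
  fixes X :: "'a set" and I :: "'a set set"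
  assumes MA: MA_sigma_centered
    and X: "countable X" "infinite X"
    and I: "is_ideal_on X I"
    and su: "strongly_unboring I"
  shows "\<exists>\<A>. almost_disjoint_family \<A> \<and> uncountable (topspace (Mrowka \<A>)) \<and>
             separable_space (Mrowka \<A>) \<and> FinBW I (Mrowka \<A>)"
proof -
  obtain \<A> where \<A>: "almost_disjoint_family \<A>" "uncountable \<A>"
    "\<And>C g. C \<subseteq> X \<Longrightarrow> task I C g \<Longrightarrow> served I C g \<A>"
    using MA_uncountable_family_serving_all_tasks[OF MA X(1) I] by blast
  have "FinBW I (Mrowka \<A>)" using X(1) I su \<A>(1,3) by (rule FinBW_Mrowka)
  with \<A> show ?thesis
    using uncountable_topspace_Mrowka separable_space_Mrowka by (intro exI[of _ \<A>]) simp
qed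

end
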